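(* Let $B\in\mathbb{R}^{m\times n}$ have full column rank, with $m>n$. Let $x,y\in\mathbb{R}^m$, assume $x\in\operatorname{span}(B)^\perp$ and $x+y\neq 0$, and define $$q=\frac{x+y}{\|x+y\|_2},\qquad \gamma=\frac{1}{\|x+y\|_2}.$$ Then $$\kappa([B,q])\le \sqrt{\frac{\max\{\sigma_{\max}^2(B),1\}+\gamma\|B^Ty\|_2}{\min\{\sigma_{\min}^2(B),1\}-\gamma\|B^Ty\|_2}},$$ provided $\gamma\|B^Ty\|_2<\min\{\sigma_{\min}^2(B),1\}$. If, in addition, the columns of $B$ have unit (Euclidean) norm and $\delta$ is a real number with $$\gamma\|B^Ty\|_2\leq \delta<\sigma_{\min}^2(B),$$ then $$\kappa([B,q])\le \kappa(B)\sqrt{1+\frac{\delta\,(1+\kappa(B)^{-2})}{\sigma_{\min}^2(B)-\delta}}.$$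
   Context: For a real matrix $A$, $\sigma_{\max}(A)$ and $\sigma_{\min}(A)$ denote its largest and smallest singular values (when $A$ has full column rank, $\sigma_{\min}(A)=\sqrt{\lambda_{\min}(A^TA)}$), and $\kappa(A)=\sigma_{\max}(A)/\sigma_{\min}(A)$ is the spectral condition number. $\operatorname{span}(B)$ is the column space of $B$, and $[B,q]$ is the $m\times(n+1)$ matrix obtained by appending the column $q$ to $B$. *)

theory Defs
  imports "HOL-Analysis.Analysis"
begin

definition eigvals :: "real^'n^'n \<Rightarrow> real set" where
  "eigvals M = {l. \<exists>v. v \<noteq> 0 \<and> M *v v = l *\<^sub>R v}"

text \<open>An m by n matrix has min(m, n) singular values, the square roots of the eigenvalues of the
  smaller of the two Gram matrices; the larger one may contribute spurious zeros.\<close>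

definition singular_values :: "real^'n^'m \<Rightarrow> real set" where
  "singular_values A =
     (if CARD('n) \<le> CARD('m) then sqrt ` eigvals (transpose A ** A)
      else sqrt ` eigvals (A ** transpose A))"

definition sigma_max :: "real^'n^'m \<Rightarrow> real" where
  "sigma_max A = Max (singular_values A)"

definition sigma_min :: "real^'n^'m \<Rightarrow> real" where
  "sigma_min A = Min (singular_values A)"

text \<open>As a real quotient this is 0, not infinity, when \<open>sigma_min A = 0\<close>, so an upper bound on it
  is meaningful only together with \<open>0 < sigma_min A\<close>.\<close>

definition cond_num :: "real^'n^'m \<Rightarrow> real" where
  "cond_num A = sigma_max A / sigma_min A"

text \<open>The matrix [B, q]: the index type \<open>'n option\<close> has one element more than \<open>'n\<close>, and
  \<open>None\<close> indexes the new column. Singular values do not depend on the order of the columns.\<close>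

definition append_column :: "real^'n^'m \<Rightarrow> real^'m \<Rightarrow> real^('n option)^'m" where
  "append_column B q = (\<chi> i j. case j of None \<Rightarrow> q $ i | Some k \<Rightarrow> B $ i $ k)"

end

theory Submission
  imports Defs
begin

text \<open>The extreme singular values of \<open>A\<close> are the extreme values of \<open>norm (A *v w)\<close> over unit
  vectors \<open>w\<close>. Writing \<open>w = (v, t)\<close>, one has \<open>[B, q] w = B v + t q\<close> with \<open>norm q = 1\<close>, and as
  \<open>x\<close> is orthogonal to the range of \<open>B\<close>, the cross term \<open>2 t (B v \<bullet> q)\<close> equals
  \<open>2 t \<gamma> (v \<bullet> B\<^sup>T y)\<close>. It is at most \<open>\<gamma> norm (B\<^sup>T y) (norm v ^ 2 + t ^ 2)\<close> in absolute value,
  so it perturbs the squared extreme singular values of \<open>B\<close> and \<open>1\<close> by at most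
  \<open>\<gamma> norm (B\<^sup>T y)\<close>. When the columns of \<open>B\<close> are unit vectors, its singular values enclose \<open>1\<close>,
  and the second bound is the first one rewritten.\<close>

section \<open>Adjoints, Gram matrices and semidefinite forms\<close>

lemma inner_matrix_vector_transpose:
  fixes A :: "real^'n^'m"
  shows "(A *v v) \<bullet> y = v \<bullet> (transpose A *v y)"
  by (metis dot_lmul_matrix inner_commute transpose_matrix_vector)

lemma inner_gram_matrix:
  fixes A :: "real^'n^'m"
  shows "v \<bullet> ((transpose A ** A) *v v) = (norm (A *v v))\<^sup>2"
  unfolding power2_norm_eq_inner inner_matrix_vector_transpose
  by (simp only: matrix_vector_mul_assoc)

lemma inner_symmetric_matrix:
  fixes S :: "real^'n^'n"
  assumes "transpose S = S"
  shows "v \<bullet> (S *v w) = (S *v v) \<bullet> w"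
  by (metis assms dot_lmul_matrix transpose_matrix_vector)

text \<open>A zero of a nonnegative form is a minimum, so the gradient
  \<open>2 *\<^sub>R (S *v u)\<close> vanishes there. Concretely, a small step from \<open>u\<close>
  against \<open>w = S *v u\<close> would make the form negative unless
  \<open>w = 0\<close>.\<close>

lemma psd_zero_imp_kernel:
  fixes S :: "real^'n^'n"
  assumes sym: "transpose S = S" and psd: "\<And>v. 0 \<le> v \<bullet> (S *v v)" and u: "u \<bullet> (S *v u) = 0"
  shows "S *v u = 0"
proof -
  define w where "w = S *v u"
  define a where "a = w \<bullet> w"
  define c where "c = w \<bullet> (S *v w)"
  \<comment> \<open>The parabola \<open>2 * t * a + t\<^sup>2 * c\<close> has its minimum at
    \<open>- a / c\<close>; the added 1 covers \<open>c = 0\<close> and still gives a negative value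
    unless \<open>a = 0\<close>.\<close>
  define t where "t = - a / (c + 1)"
  have c: "c \<ge> 0" unfolding c_def by (rule psd)
  have uw: "u \<bullet> (S *v w) = a"
    by (simp add: inner_symmetric_matrix[OF sym] a_def w_def)
  have "(u + t *\<^sub>R w) \<bullet> (S *v (u + t *\<^sub>R w)) = 2 * t * a + t\<^sup>2 * c"
  proof -
    have "S *v u = w" "u \<bullet> w = 0" "w \<bullet> w = a" "w \<bullet> (S *v w) = c"
      using u by (simp_all add: w_def a_def c_def)
    then show ?thesis
      using uw by (simp add: matrix_vector_right_distrib matrix_vector_mult_scaleR
          inner_add_left inner_add_right power2_eq_square algebra_simps)
  qed
  then have "0 \<le> 2 * t * a + t\<^sup>2 * c"
    by (metis psd)
  also have "\<dots> = - (a\<^sup>2 * (c + 2)) / (c + 1)\<^sup>2"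
    using c by (simp add: t_def divide_simps power2_eq_square) (simp add: algebra_simps)
  finally have "a\<^sup>2 * (c + 2) \<le> 0"
    using c by (simp add: divide_simps)
  then have "a = 0"
    using c by (simp add: mult_le_0_iff)
  then show ?thesis
    by (simp add: a_def w_def)
qed

section \<open>Extreme eigenvalues of symmetric matrices\<close>

lemma uminus_matrix_vector_mult:
  fixes S :: "real^'n^'m"
  shows "(- S) *v v = - (S *v v)"
  by (simp add: matrix_vector_mult_def vec_eq_iff sum_negf)

lemma eigvals_uminus: "l \<in> eigvals (- S) \<longleftrightarrow> - l \<in> eigvals S"
  by (simp add: eigvals_def uminus_matrix_vector_mult) (metis minus_equation_iff)

text \<open>By compactness the form attains its minimum \<open>l\<close> on the unit sphere, at some
  \<open>u\<close>. Then \<open>S - l *\<^sub>R mat 1\<close> is positive semidefinite and its form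
  vanishes at \<open>u\<close>, so \<open>u\<close> lies in its kernel and is an eigenvector of
  \<open>S\<close> for \<open>l\<close>.\<close>

lemma symmetric_matrix_rayleigh_min:
  fixes S :: "real^'n^'n"
  assumes sym: "transpose S = S"
  obtains l where "l \<in> eigvals S" "\<And>v. l * (norm v)\<^sup>2 \<le> v \<bullet> (S *v v)"
proof -
  have "\<exists>u\<in>sphere 0 1. \<forall>v\<in>sphere (0::real^'n) 1. u \<bullet> (S *v u) \<le> v \<bullet> (S *v v)"
    by (rule continuous_attains_inf)
      (auto intro!: continuous_intros matrix_vector_mult_linear_continuous_on)
  then obtain u :: "real^'n" where u: "norm u = 1"
    and min: "\<And>v. norm v = 1 \<Longrightarrow> u \<bullet> (S *v u) \<le> v \<bullet> (S *v v)"
    by auto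
  define l where "l = u \<bullet> (S *v u)"
  have bound: "l * (norm v)\<^sup>2 \<le> v \<bullet> (S *v v)" for v
  proof (cases "v = 0")
    case False
    have "l \<le> (v /\<^sub>R norm v) \<bullet> (S *v (v /\<^sub>R norm v))"
      unfolding l_def using False by (intro min) simp
    also have "\<dots> = v \<bullet> (S *v v) / (norm v)\<^sup>2"
      by (simp add: matrix_vector_mult_scaleR power2_eq_square divide_simps)
    finally show ?thesis
      using False by (simp add: divide_simps mult.commute)
  qed simp
  define T where "T = S - l *\<^sub>R mat 1"
  have T: "T *v v = S *v v - l *\<^sub>R v" for v
    by (simp add: T_def matrix_vector_mult_diff_rdistrib flip: scaleR_matrix_vector_assoc)
  have "transpose T = T"
    using sym by (auto simp: T_def transpose_def vec_eq_iff mat_def)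
  moreover have "0 \<le> v \<bullet> (T *v v)" for v
    using bound[of v] by (simp add: T inner_diff_right power2_norm_eq_inner)
  moreover have "u \<bullet> (T *v u) = 0"
    using u by (simp add: T inner_diff_right l_def flip: power2_norm_eq_inner)
  ultimately have "T *v u = 0"
    by (rule psd_zero_imp_kernel)
  then have "l \<in> eigvals S"
    using u by (auto simp: T eigvals_def intro!: exI[of _ u])
  then show ?thesis
    using bound that by blast
qed

lemma symmetric_matrix_rayleigh_max:
  fixes S :: "real^'n^'n"
  assumes sym: "transpose S = S"
  obtains l where "l \<in> eigvals S" "\<And>v. v \<bullet> (S *v v) \<le> l * (norm v)\<^sup>2"
proof -
  have "transpose (- S) = - S"
    using sym by (simp add: transpose_def vec_eq_iff)
  then obtain l where l: "l \<in> eigvals (- S)" "\<And>v. l * (norm v)\<^sup>2 \<le> v \<bullet> ((- S) *v v)"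
    using symmetric_matrix_rayleigh_min by blast
  show ?thesis
  proof
    show "- l \<in> eigvals S"
      using l(1) by (simp add: eigvals_uminus)
    show "v \<bullet> (S *v v) \<le> - l * (norm v)\<^sup>2" for v
      using l(2)[of v] by (simp add: uminus_matrix_vector_mult)
  qed
qed

text \<open>Eigenvectors for distinct eigenvalues are orthogonal, and a pairwise orthogonal set is
  finite. This gives \<open>Max\<close> and \<open>Min\<close> in \<open>sigma_max\<close> and
  \<open>sigma_min\<close> their meaning.\<close>

lemma finite_eigvals_symmetric:
  fixes S :: "real^'n^'n"
  assumes sym: "transpose S = S"
  shows "finite (eigvals S)"
proof -
  define e where "e l = (SOME v. v \<noteq> 0 \<and> S *v v = l *\<^sub>R v)" for l
  have e: "e l \<noteq> 0 \<and> S *v e l = l *\<^sub>R e l" if "l \<in> eigvals S" for l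
    unfolding e_def by (rule someI_ex) (use that in \<open>simp add: eigvals_def\<close>)
  have orth: "e l \<bullet> e k = 0" if "l \<in> eigvals S" "k \<in> eigvals S" "l \<noteq> k" for l k
    \<comment> \<open>Evaluating \<open>e l \<bullet> (S *v e k)\<close> on either side gives
      \<open>k\<close> times and \<open>l\<close> times the same inner product.\<close>
    using inner_symmetric_matrix[OF sym, of "e l" "e k"] e that by simp
  have "inj_on e (eigvals S)"
    by (rule inj_onI) (metis e orth inner_eq_zero_iff)
  moreover have "pairwise orthogonal (e ` eigvals S)"
    by (auto simp: pairwise_def orthogonal_def intro: orth)
  then have "finite (e ` eigvals S)"
    by (rule pairwise_orthogonal_imp_finite)
  ultimately show ?thesis
    by (simp add: finite_image_iff)
qed

section \<open>Singular values as extreme stretching factors\<close>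

lemma eigval_gramE:
  fixes A :: "real^'n^'m"
  assumes "l \<in> eigvals (transpose A ** A)"
  obtains v where "v \<noteq> 0" "(norm (A *v v))\<^sup>2 = l * (norm v)\<^sup>2"
proof -
  obtain v where v: "v \<noteq> 0" "(transpose A ** A) *v v = l *\<^sub>R v"
    using assms by (auto simp: eigvals_def)
  have "(norm (A *v v))\<^sup>2 = l * (norm v)\<^sup>2"
    using inner_gram_matrix[of v A] by (simp add: v power2_norm_eq_inner)
  with v(1) that show ?thesis by blast
qed

lemma singular_values_variational:
  fixes A :: "real^'n^'m"
  assumes le: "CARD('n) \<le> CARD('m)"
  shows "sigma_min A * norm v \<le> norm (A *v v)"
    and "norm (A *v v) \<le> sigma_max A * norm v"
    and "\<exists>u. u \<noteq> 0 \<and> norm (A *v u) = sigma_min A * norm u"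
    and "\<exists>u. u \<noteq> 0 \<and> norm (A *v u) = sigma_max A * norm u"
proof -
  let ?S = "transpose A ** A"
  have sym: "transpose ?S = ?S"
    by (simp add: matrix_transpose_mul)
  \<comment> \<open>\<open>le\<close> selects the Gram matrix whose quadratic form is
    \<open>(norm (A *v v))\<^sup>2\<close>.\<close>
  have sv: "singular_values A = sqrt ` eigvals ?S"
    using le by (simp add: singular_values_def)
  have fin: "finite (singular_values A)"
    by (simp add: sv finite_eigvals_symmetric[OF sym])
  have attained: "\<exists>u. u \<noteq> 0 \<and> norm (A *v u) = s * norm u" if s: "s \<in> singular_values A" for s
  proof -
    obtain l where l: "l \<in> eigvals ?S" "s = sqrt l" using s by (auto simp: sv)
    from l(1) obtain u where u: "u \<noteq> 0" "(norm (A *v u))\<^sup>2 = l * (norm u)\<^sup>2"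
      by (rule eigval_gramE)
    \<comment> \<open>No sign condition on \<open>l\<close> arises, as \<open>sqrt\<close> is
      multiplicative on all reals.\<close>
    then have "norm (A *v u) = s * norm u"
      by (metis l(2) abs_norm_cancel real_sqrt_abs real_sqrt_mult)
    with u(1) show ?thesis by blast
  qed
  obtain l where l: "l \<in> eigvals ?S" "\<And>v. l * (norm v)\<^sup>2 \<le> v \<bullet> (?S *v v)"
    using symmetric_matrix_rayleigh_min[OF sym] by blast
  obtain k where k: "k \<in> eigvals ?S" "\<And>v. v \<bullet> (?S *v v) \<le> k * (norm v)\<^sup>2"
    using symmetric_matrix_rayleigh_max[OF sym] by blast
  \<comment> \<open>\<open>sqrt l\<close> is a singular value, so the minimum lies below it; the
    Rayleigh bound for \<open>l\<close> completes the chain.\<close>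
  have "sigma_min A \<le> sqrt l"
    using l(1) fin by (simp add: sigma_min_def sv)
  moreover have "sqrt l * norm v \<le> norm (A *v v)"
    using l(2)[of v] real_sqrt_le_mono by (fastforce simp: inner_gram_matrix real_sqrt_mult)
  ultimately show "sigma_min A * norm v \<le> norm (A *v v)"
    by (meson mult_right_mono norm_ge_zero order_trans)
  have "sqrt k \<le> sigma_max A"
    using k(1) fin by (simp add: sigma_max_def sv)
  moreover have "norm (A *v v) \<le> sqrt k * norm v"
    using k(2)[of v] real_sqrt_le_mono by (fastforce simp: inner_gram_matrix real_sqrt_mult)
  ultimately show "norm (A *v v) \<le> sigma_max A * norm v"
    by (meson mult_right_mono norm_ge_zero order_trans)
  have ne: "singular_values A \<noteq> {}"
    using l(1) by (auto simp: sv)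
  show "\<exists>u. u \<noteq> 0 \<and> norm (A *v u) = sigma_min A * norm u"
    using attained Min_in[OF fin ne] by (simp add: sigma_min_def)
  show "\<exists>u. u \<noteq> 0 \<and> norm (A *v u) = sigma_max A * norm u"
    using attained Max_in[OF fin ne] by (simp add: sigma_max_def)
qed

text \<open>\<open>sqrt\<close> is negative on negative reals, so the sign is read off from a
  nonzero \<open>u\<close> at which the stretching factor is attained.\<close>

lemma sigma_nonneg:
  fixes A :: "real^'n^'m"
  assumes "CARD('n) \<le> CARD('m)"
  shows "0 \<le> sigma_min A" and "0 \<le> sigma_max A"
proof -
  obtain u where "u \<noteq> 0" "norm (A *v u) = sigma_min A * norm u"
    using singular_values_variational(3)[OF assms] by blast
  then show "0 \<le> sigma_min A"
    by (metis norm_ge_zero zero_le_mult_iff norm_le_zero_iff)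
  obtain u where "u \<noteq> 0" "norm (A *v u) = sigma_max A * norm u"
    using singular_values_variational(4)[OF assms] by blast
  then show "0 \<le> sigma_max A"
    by (metis norm_ge_zero zero_le_mult_iff norm_le_zero_iff)
qed

text \<open>Testing the bounds on vectors that attain the extremes gives
  \<open>a \<le> (sigma_min A)\<^sup>2\<close> and
  \<open>(sigma_max A)\<^sup>2 \<le> b\<close>.\<close>

lemma cond_num_le_sqrt:
  fixes A :: "real^'n^'m"
  assumes card: "CARD('n) \<le> CARD('m)" and a: "0 < a"
    and lower: "\<And>v. a * (norm v)\<^sup>2 \<le> (norm (A *v v))\<^sup>2"
    and upper: "\<And>v. (norm (A *v v))\<^sup>2 \<le> b * (norm v)\<^sup>2"
  shows "0 < sigma_min A \<and> cond_num A \<le> sqrt (b / a)"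
proof -
  obtain u where u: "u \<noteq> 0" "norm (A *v u) = sigma_min A * norm u"
    using singular_values_variational(3)[OF card] by blast
  have min: "a \<le> (sigma_min A)\<^sup>2"
    using lower[of u] u by (simp add: power_mult_distrib)
  obtain w where w: "w \<noteq> 0" "norm (A *v w) = sigma_max A * norm w"
    using singular_values_variational(4)[OF card] by blast
  have max: "(sigma_max A)\<^sup>2 \<le> b"
    using upper[of w] w by (simp add: power_mult_distrib)
  have pos: "0 < sigma_min A"
    using min a sigma_nonneg(1)[OF card, of A] by (cases "sigma_min A = 0") auto
  have "(cond_num A)\<^sup>2 \<le> b / a"
    unfolding cond_num_def power_divide
    using min max a by (intro frac_le) (auto intro: order_trans[OF zero_le_power2])
  then show ?thesis
    using pos real_le_rsqrt by blast
qed

section \<open>Appending a unit column\<close>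

lemma sum_option:
  fixes f :: "'n::finite option \<Rightarrow> 'a::comm_monoid_add"
  shows "sum f UNIV = f None + (\<Sum>k\<in>UNIV. f (Some k))"
  by (simp add: UNIV_option_conv sum.reindex)

lemma append_column_mult:
  "append_column B q *v w = B *v (\<chi> k. w $ Some k) + w $ None *\<^sub>R q"
  by (simp add: append_column_def matrix_vector_mult_def vec_eq_iff sum_option
      mult.commute add.commute)

lemma norm_vec_option:
  fixes w :: "real^('n::finite option)"
  shows "(norm w)\<^sup>2 = (norm (\<chi> k. w $ Some k :: real^'n))\<^sup>2 + (w $ None)\<^sup>2"
  unfolding power2_norm_eq_inner inner_vec_def by (simp add: sum_option power2_eq_square)

lemma append_column_bounds:
  fixes B :: "real^'n^'m" and w :: "real^('n option)"
  assumes card: "CARD('n) \<le> CARD('m)" and q: "norm q = 1"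
    and g: "\<And>v. \<bar>(B *v v) \<bullet> q\<bar> \<le> g * norm v"
  shows "(min ((sigma_min B)\<^sup>2) 1 - g) * (norm w)\<^sup>2 \<le> (norm (append_column B q *v w))\<^sup>2"
    and "(norm (append_column B q *v w))\<^sup>2 \<le> (max ((sigma_max B)\<^sup>2) 1 + g) * (norm w)\<^sup>2"
proof -
  define v :: "real^'n" where "v = (\<chi> k. w $ Some k)"
  define t where "t = w $ None"
  define c where "c = 2 * t * ((B *v v) \<bullet> q)"
  let ?a = "min ((sigma_min B)\<^sup>2) 1" and ?b = "max ((sigma_max B)\<^sup>2) 1"
  have nw: "(norm w)\<^sup>2 = (norm v)\<^sup>2 + t\<^sup>2"
    by (simp add: norm_vec_option v_def t_def)
  have split: "(norm (append_column B q *v w))\<^sup>2 = (norm (B *v v))\<^sup>2 + c + t\<^sup>2"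
    unfolding append_column_mult power2_norm_eq_inner v_def[symmetric] t_def[symmetric] c_def
    using q by (simp add: norm_eq_1 inner_add_left inner_add_right
        inner_commute[of q "B *v v"] power2_eq_square distrib_left)
  \<comment> \<open>The hypothesis on a unit vector bounds an absolute value by \<open>g\<close>;
    the sign permits scaling the inequality \<open>2 * norm v * \<bar>t\<bar> \<le> (norm v)\<^sup>2
    + \<bar>t\<bar>\<^sup>2\<close> by \<open>g\<close>.\<close>
  have g0: "0 \<le> g"
    using order_trans[OF abs_ge_zero g[of "axis undefined 1"]] by simp
  have "\<bar>c\<bar> \<le> 2 * \<bar>t\<bar> * (g * norm v)"
    unfolding c_def abs_mult using g[of v] by (intro mult_mono) auto
  also have "\<dots> = g * (2 * norm v * \<bar>t\<bar>)" by simp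
  also have "\<dots> \<le> g * ((norm v)\<^sup>2 + \<bar>t\<bar>\<^sup>2)"
    using g0 sum_squares_bound[of "norm v" "\<bar>t\<bar>"] by (intro mult_left_mono)
  finally have c: "\<bar>c\<bar> \<le> g * (norm w)\<^sup>2"
    by (simp add: nw)
  \<comment> \<open>The minimum is relaxed separately: to \<open>(sigma_min B)\<^sup>2\<close> on
    \<open>v\<close> and to 1 on \<open>t\<close>.\<close>
  have "?a * (norm w)\<^sup>2 \<le> (sigma_min B)\<^sup>2 * (norm v)\<^sup>2 + 1 * t\<^sup>2"
    unfolding nw distrib_left by (intro add_mono mult_right_mono) auto
  also have "\<dots> \<le> (norm (B *v v))\<^sup>2 + t\<^sup>2"
    using power_mono[OF singular_values_variational(1)[OF card, of B v], of 2]
      sigma_nonneg(1)[OF card, of B]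
    by (simp add: power_mult_distrib)
  finally show "(?a - g) * (norm w)\<^sup>2 \<le> (norm (append_column B q *v w))\<^sup>2"
    using c by (simp add: split left_diff_distrib)
  have "(norm (B *v v))\<^sup>2 + t\<^sup>2 \<le> (sigma_max B)\<^sup>2 * (norm v)\<^sup>2 + 1 * t\<^sup>2"
    using power_mono[OF singular_values_variational(2)[OF card, of B v], of 2]
    by (simp add: power_mult_distrib)
  also have "\<dots> \<le> ?b * (norm w)\<^sup>2"
    unfolding nw distrib_left by (intro add_mono mult_right_mono) auto
  finally show "(norm (append_column B q *v w))\<^sup>2 \<le> (?b + g) * (norm w)\<^sup>2"
    using c by (simp add: split distrib_right)
qed

section \<open>Unit columns and the two condition number bounds\<close>

lemma sigma_unit_columns:
  fixes B :: "real^'n^'m"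
  assumes "CARD('n) \<le> CARD('m)" and "\<forall>j. norm (column j B) = 1"
  shows "sigma_min B \<le> 1" and "1 \<le> sigma_max B"
  \<comment> \<open>A unit coordinate vector is mapped to a column, so its stretching factor is
    1.\<close>
  using singular_values_variational(1,2)[OF assms(1), of B "axis undefined 1"] assms(2)
  by (simp_all add: matrix_vector_mult_basis)

text \<open>Over the common denominator the bracket has numerator
  \<open>s\<^sup>2 * (1 + \<delta> / S\<^sup>2)\<close>, since \<delta> cancels; the factor
  \<open>(S / s)\<^sup>2\<close> turns this into \<open>S\<^sup>2 + \<delta>\<close>.\<close>

lemma condition_bound_eq:
  fixes s S \<delta> :: real
  assumes "0 < s" "0 < S" "\<delta> < s\<^sup>2"
  shows "sqrt ((S\<^sup>2 + \<delta>) / (s\<^sup>2 - \<delta>)) =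
    S / s * sqrt (1 + \<delta> * (1 + (S / s) powi (-2)) / (s\<^sup>2 - \<delta>))"
proof -
  have nz: "s\<^sup>2 - \<delta> \<noteq> 0" using assms by simp
  have "(S / s)\<^sup>2 * (1 + \<delta> * (1 + (S / s) powi (-2)) / (s\<^sup>2 - \<delta>))
      = (S / s)\<^sup>2 * (1 + \<delta> * (1 + s\<^sup>2 / S\<^sup>2) / (s\<^sup>2 - \<delta>))"
    by (simp add: power_int_minus power_divide)
  also have "\<dots> = (S\<^sup>2 + \<delta>) / (s\<^sup>2 - \<delta>)"
    using assms nz by (simp add: power_divide divide_simps) (simp add: algebra_simps)
  finally show ?thesis
    using assms by (metis real_sqrt_mult real_sqrt_abs abs_of_pos divide_pos_pos)
qed

theorem theorem3p2:
  fixes B :: "real^'n^'m" and x y q :: "real^'m" and \<gamma> :: real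
  assumes "CARD('n) < CARD('m)"
    and "rank B = CARD('n)"
    and "x \<in> (span (columns B))\<^sup>\<bottom>"
    and "x + y \<noteq> 0"
    and "q = (x + y) /\<^sub>R norm (x + y)"
    and "\<gamma> = 1 / norm (x + y)"
  shows "(\<gamma> * norm (transpose B *v y) < min ((sigma_min B)\<^sup>2) 1 \<longrightarrow>
            0 < sigma_min (append_column B q) \<and>
            cond_num (append_column B q)
              \<le> sqrt ((max ((sigma_max B)\<^sup>2) 1 + \<gamma> * norm (transpose B *v y)) /
                      (min ((sigma_min B)\<^sup>2) 1 - \<gamma> * norm (transpose B *v y))))
       \<and> (\<forall>\<delta>::real. (\<forall>j. norm (column j B) = 1) \<and>
            \<gamma> * norm (transpose B *v y) \<le> \<delta> \<and> \<delta> < (sigma_min B)\<^sup>2 \<longrightarrow>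
            0 < sigma_min (append_column B q) \<and>
            cond_num (append_column B q)
              \<le> cond_num B *
                sqrt (1 + \<delta> * (1 + cond_num B powi (-2)) / ((sigma_min B)\<^sup>2 - \<delta>)))"
proof (intro conjI allI impI)
  let ?A = "append_column B q" and ?g = "\<gamma> * norm (transpose B *v y)"
  have card: "CARD('n) \<le> CARD('m)" and card': "CARD('n option) \<le> CARD('m)"
    using assms(1) by auto
  have q: "norm q = 1"
    using assms(4,5) by simp
  have \<gamma>: "0 < \<gamma>"
    using assms(4,6) by simp
  have cross: "\<bar>(B *v v) \<bullet> q\<bar> \<le> ?g * norm v" for v
  proof -
    have "B *v v \<in> span (columns B)"
      by (simp add: matrix_vector_mult_in_columnspace)
    then have "(B *v v) \<bullet> x = 0"
      using assms(3) by (auto simp: orthogonal_comp_def orthogonal_def inner_commute)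
    then have "(B *v v) \<bullet> q = \<gamma> * ((transpose B *v y) \<bullet> v)"
      unfolding inner_commute[of _ v] inner_matrix_vector_transpose[symmetric]
      using assms(5,6) by (simp add: inner_add_right divide_inverse)
    also have "\<bar>\<dots>\<bar> \<le> ?g * norm v"
      using \<gamma> Cauchy_Schwarz_ineq2 by (simp add: abs_mult)
    finally show ?thesis .
  qed
  note bounds = append_column_bounds[OF card q cross]
  \<comment> \<open>Both halves of the theorem start from this estimate.\<close>
  have main: "0 < sigma_min ?A \<and> cond_num ?A
      \<le> sqrt ((max ((sigma_max B)\<^sup>2) 1 + ?g) / (min ((sigma_min B)\<^sup>2) 1 - ?g))"
    if "?g < min ((sigma_min B)\<^sup>2) 1"
    by (rule cond_num_le_sqrt[OF card' _ bounds]) (use that in simp)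
  {
    assume "?g < min ((sigma_min B)\<^sup>2) 1"
    from main[OF this] show "0 < sigma_min ?A" and "cond_num ?A
      \<le> sqrt ((max ((sigma_max B)\<^sup>2) 1 + ?g) / (min ((sigma_min B)\<^sup>2) 1 - ?g))"
      by auto
  }
  fix \<delta> :: real
  assume asm: "(\<forall>j. norm (column j B) = 1) \<and> ?g \<le> \<delta> \<and> \<delta> < (sigma_min B)\<^sup>2"
  then have min1: "sigma_min B \<le> 1" and max1: "1 \<le> sigma_max B"
    using sigma_unit_columns[OF card] by blast+
  have g0: "0 \<le> ?g" using \<gamma> by simp
  \<comment> \<open>Positivity comes from the chain
    \<open>0 \<le> ?g \<le> \<delta> < (sigma_min B)\<^sup>2\<close>.\<close>
  have pos: "0 < sigma_min B"
    using asm g0 sigma_nonneg(1)[OF card, of B] by (cases "sigma_min B = 0") auto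
  have mn: "min ((sigma_min B)\<^sup>2) 1 = (sigma_min B)\<^sup>2"
    using min1 pos by (simp add: power_le_one)
  have mx: "max ((sigma_max B)\<^sup>2) 1 = (sigma_max B)\<^sup>2"
    using max1 by simp
  have A: "0 < sigma_min ?A"
    "cond_num ?A \<le> sqrt (((sigma_max B)\<^sup>2 + ?g) / ((sigma_min B)\<^sup>2 - ?g))"
    using main asm unfolding mn mx by auto
  show "0 < sigma_min ?A" by (rule A)
  note A(2)
  \<comment> \<open>Passing from \<open>?g\<close> to \<delta> raises the numerator and lowers the
    denominator, which stays positive.\<close>
  also have "sqrt (((sigma_max B)\<^sup>2 + ?g) / ((sigma_min B)\<^sup>2 - ?g))
      \<le> sqrt (((sigma_max B)\<^sup>2 + \<delta>) / ((sigma_min B)\<^sup>2 - \<delta>))"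
    using asm g0 by (intro real_sqrt_le_mono frac_le) auto
  also have "\<dots> = cond_num B *
      sqrt (1 + \<delta> * (1 + cond_num B powi (-2)) / ((sigma_min B)\<^sup>2 - \<delta>))"
    unfolding cond_num_def using asm pos max1 by (intro condition_bound_eq) auto
  finally show "cond_num ?A \<le> cond_num B *
      sqrt (1 + \<delta> * (1 + cond_num B powi (-2)) / ((sigma_min B)\<^sup>2 - \<delta>))" .
qed

end
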